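(* Let $N\ge 1$ and $S=\{(s_1,\ldots,s_N)\,:\,1\le s_i\le 2 \text{ for all } i\}=\{1,2\}^N$. Let $\phi=\frac{\sqrt5-1}{2}$, $A=-\phi^{N-1}(1+\phi)^{N-1}(1+2\phi)$, $h=N\Bigl(\frac{\phi}{1+3\phi+2\phi^2}\Bigr)^{N-1}$ and $b_0=\frac{1}{-\phi A\sqrt{(2\pi)^{N-1}h}}$. Then, as $\ell\to\infty$, $$a_S(\ell,\ldots,\ell)\sim \phi^{-\ell N}\, b_0\, \ell^{(1-N)/2}.$$
   Context: For $S\subseteq\mathbb{N}^N$ and $(\ell_1,\ldots,\ell_N)\in\mathbb{N}^N$, $a_S(\ell_1,\ldots,\ell_N)$ denotes the number of $N\times k$ matrices (over all $k\ge 1$) with non-negative integer entries whose $i$-th row sums to $\ell_i$ for each $i$ and each of whose columns is an element of $S$ ($S$-alignments). $a_S(\ell,\ldots,\ell)$ has all $N$ arguments equal to $\ell$. *)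

theory Defs
  imports Complex_Main "HOL-Library.Landau_Symbols" "Jordan_Normal_Form.Matrix"
begin

definition alignments :: "nat \<Rightarrow> nat vec set \<Rightarrow> nat vec \<Rightarrow> nat mat set" where
  "alignments N S l =
     {M. \<exists>k\<ge>1. M \<in> carrier_mat N k \<and>
           (\<forall>i<N. (\<Sum>j<k. M $$ (i, j)) = l $ i) \<and>
           (\<forall>j<k. col M j \<in> S)}"

(* If S contains the zero vector, then alignments N S l is either empty or infinite,
   and in the latter case the value below is 0 by the convention for card. *)
definition num_alignments :: "nat \<Rightarrow> nat vec set \<Rightarrow> nat vec \<Rightarrow> nat" where
  "num_alignments N S l = card (alignments N S l)"

end

(* An alignment with k columns over {1,2}^N consists of N independent rows, each a sequence of k ones
   and twos with sum l; there are (k choose (l - k)) of these. With phi + phi^2 = 1, the number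
   (k choose (l - k)) phi^l is the probability that a random walk with steps 1 and 2, taken with
   probabilities phi and phi^2, is at l after k steps. By the local limit theorem for the binomial
   distribution these probabilities have, at scale sqrt l around k = l / mu (mu the mean step), a
   Gaussian limit, and they are O(1 / sqrt l). Their sum over k is a rescaled Fibonacci number, so its
   limit is known and agrees with the mass of the Gaussian. Scheffe's lemma then gives L1 convergence,
   which together with the uniform bound passes to N-th powers; the constant is a Gaussian integral. *)
theory Submission
  imports Defs "HOL-Probability.Probability" "HOL-Number_Theory.Fib"
begin

section \<open>Counting alignments\<close>

definition one_two_alignments :: "nat \<Rightarrow> nat \<Rightarrow> nat \<Rightarrow> nat mat set" where
  "one_two_alignments N l k = {M \<in> carrier_mat N k. (\<forall>i<N. (\<Sum>j<k. M $$ (i, j)) = l) \<and>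
     (\<forall>j<k. col M j \<in> {s \<in> carrier_vec N. \<forall>i<N. 1 \<le> vec_index s i \<and> vec_index s i \<le> 2})}"

text \<open>The rows are independent, and a row of ones and twos is determined by the positions of
  its twos; sum \<open>l\<close> over \<open>k\<close> columns forces exactly \<open>l - k\<close>
  of them. The case split guards against truncated subtraction: for \<open>k > l\<close> the
  binomial coefficient would be 1, although no matrix exists.\<close>

lemma one_two_alignments_finite_card:
  assumes "N > 0"
  shows "finite (one_two_alignments N l k) \<and>
    card (one_two_alignments N l k) = (if k \<le> l then (k choose (l - k)) ^ N else 0)"
    (is "finite ?A \<and> _")
proof (cases "k \<le> l")
  case True
  define R where "R = {B. B \<subseteq> {..<k} \<and> card B = l - k}"
  \<comment> \<open>\<open>G i\<close> is the set of positions of the twos in row \<open>i\<close>.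
    Taking \<open>G\<close> from \<open>PiE\<close> fixes its values outside the rows, which makes
    \<open>F\<close> injective.\<close>
  define F where "F = (\<lambda>G::nat \<Rightarrow> nat set. Matrix.mat N k (\<lambda>(i, j). if j \<in> G i then 2 else 1 :: nat))"
  have sum2: "(\<Sum>j<k. if j \<in> B then 2 else 1 :: nat) = k + card B" if "B \<subseteq> {..<k}" for B
  proof -
    have "(\<Sum>j<k. if j \<in> B then 2 else 1 :: nat) = (\<Sum>j<k. 1 + (if j \<in> B then 1 else 0))"
      by (intro sum.cong) auto
    also have "\<dots> = k + card ({..<k} \<inter> B)"
      by (simp only: sum.distrib sum.inter_restrict [symmetric] finite_lessThan) simp
    finally show ?thesis using that by (simp add: Int_absorb1)
  qed
  have "bij_betw F (PiE {..<N} (\<lambda>_. R)) ?A"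
    unfolding bij_betw_def
  proof
    show "inj_on F (PiE {..<N} (\<lambda>_. R))"
    proof (rule inj_onI)
      fix G H assume G: "G \<in> PiE {..<N} (\<lambda>_. R)" and H: "H \<in> PiE {..<N} (\<lambda>_. R)" and eq: "F G = F H"
      have iff: "j \<in> G i \<longleftrightarrow> j \<in> H i" if "i < N" "j < k" for i j
        using arg_cong[OF eq, of "\<lambda>M. M $$ (i, j)"] that by (auto simp: F_def split: if_splits)
      show "G = H"
      proof (rule PiE_ext[OF G H])
        fix i assume "i \<in> {..<N}"
        then have "G i \<subseteq> {..<k}" "H i \<subseteq> {..<k}"
          using G H by (auto simp: R_def dest!: PiE_mem)
        then show "G i = H i" using iff \<open>i \<in> {..<N}\<close> by blast
      qed
    qed
    show "F ` (PiE {..<N} (\<lambda>_. R)) = ?A"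
    proof (intro equalityI subsetI)
      fix M assume "M \<in> F ` (PiE {..<N} (\<lambda>_. R))"
      then obtain G where G: "G \<in> PiE {..<N} (\<lambda>_. R)" "M = F G" by auto
      have "(\<Sum>j<k. M $$ (i, j)) = l" if "i < N" for i
      proof -
        have B: "G i \<subseteq> {..<k}" "card (G i) = l - k" using PiE_mem[OF G(1), of i] that by (auto simp: R_def)
        have "(\<Sum>j<k. M $$ (i, j)) = (\<Sum>j<k. if j \<in> G i then 2 else 1)"
          using that by (intro sum.cong) (auto simp: G F_def)
        then show ?thesis using sum2[OF B(1)] B(2) True by simp
      qed
      then show "M \<in> ?A" by (auto simp: one_two_alignments_def G F_def)
    next
      fix M assume M: "M \<in> ?A"
      then have car: "M \<in> carrier_mat N k" by (auto simp: one_two_alignments_def)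
      have ent: "M $$ (i, j) = 1 \<or> M $$ (i, j) = 2" if "i < N" "j < k" for i j
      proof -
        from M that have "1 \<le> col M j $ i \<and> col M j $ i \<le> 2" unfolding one_two_alignments_def by blast
        then show ?thesis using car that by auto
      qed
      define G where "G = restrict (\<lambda>i. {j. j < k \<and> M $$ (i, j) = 2}) {..<N}"
      have "F G = M"
      proof (rule eq_matI)
        fix i j assume "i < dim_row M" "j < dim_col M"
        then show "F G $$ (i, j) = M $$ (i, j)"
          using car ent[of i j] by (auto simp: F_def G_def)
      qed (use car in \<open>auto simp: F_def\<close>)
      moreover have "G \<in> PiE {..<N} (\<lambda>_. R)"
      proof (rule PiE_I)
        fix i assume i: "i \<in> {..<N}"
        have "l = (\<Sum>j<k. M $$ (i, j))" using M i by (auto simp: one_two_alignments_def)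
        also have "\<dots> = (\<Sum>j<k. if j \<in> G i then 2 else 1)"
        proof (rule sum.cong)
          fix j assume "j \<in> {..<k}"
          then show "M $$ (i, j) = (if j \<in> G i then 2 else 1)"
            using i ent[of i j] by (auto simp: G_def)
        qed simp
        also have "\<dots> = k + card (G i)" using i by (intro sum2) (auto simp: G_def)
        finally show "G i \<in> R" using i by (auto simp: R_def G_def)
      qed (auto simp: G_def)
      ultimately show "M \<in> F ` (PiE {..<N} (\<lambda>_. R))" by blast
    qed
  qed
  moreover have "finite (PiE {..<N} (\<lambda>_. R))"
    unfolding R_def by (intro finite_PiE) auto
  ultimately have "finite ?A" "card ?A = card (PiE {..<N} (\<lambda>_. R))"
    by (metis bij_betw_finite, metis bij_betw_same_card)
  moreover have "\<dots> = (k choose (l - k)) ^ N"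
    by (simp add: card_PiE R_def n_subsets)
  ultimately show ?thesis using True by simp
next
  case False
  \<comment> \<open>\<open>N > 0\<close> provides a row 0; its entries are at least 1, so its sum is
    at least \<open>k > l\<close>.\<close>
  have "M \<notin> ?A" for M
  proof
    assume M: "M \<in> ?A"
    then have car: "M \<in> carrier_mat N k" by (auto simp: one_two_alignments_def)
    have "1 \<le> M $$ (0, j)" if "j < k" for j
    proof -
      from M that assms have "1 \<le> col M j $ 0" unfolding one_two_alignments_def by blast
      then show ?thesis using car that assms by auto
    qed
    then have "(\<Sum>j<k. 1) \<le> (\<Sum>j<k. M $$ (0, j))" by (intro sum_mono) auto
    moreover have "(\<Sum>j<k. M $$ (0, j)) = l" using M assms by (auto simp: one_two_alignments_def)
    ultimately show False using False by simp
  qed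
  then have "?A = {}" by blast
  then show ?thesis using False by simp
qed

text \<open>Alignments are sorted by their number of columns; the classes are disjoint because the
  dimension is part of the matrix.\<close>

lemma num_alignments_diagonal:
  assumes "N > 0" "l > 0"
  shows "num_alignments N {s \<in> carrier_vec N. \<forall>i<N. 1 \<le> vec_index s i \<and> vec_index s i \<le> 2}
           (Matrix.vec N (\<lambda>_. l)) = (\<Sum>k\<le>l. (k choose (l - k)) ^ N)"
    (is "num_alignments N ?S ?v = _")
proof -
  let ?A = "one_two_alignments N l"
  note A = one_two_alignments_finite_card[OF assms(1), of l]
  have "alignments N ?S ?v = {M. \<exists>k\<ge>1. M \<in> ?A k}"
    unfolding alignments_def one_two_alignments_def by simp
  also have "\<dots> = (\<Union>k\<le>l. ?A k)"
  proof -
    \<comment> \<open>\<open>alignments\<close> demands \<open>k \<ge> 1\<close>, but the sum may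
      start at 0: for \<open>l > 0\<close> the term \<open>0 choose l\<close> vanishes.\<close>
    have "?A k = {}" if "k > l \<or> k = 0" for k
      using A[of k] that assms by (cases "k = 0") (auto simp: binomial_eq_0 zero_power)
    then have "1 \<le> k \<and> k \<le> l" if "M \<in> ?A k" for M k
      using that by (metis One_nat_def Suc_leI empty_iff not_gr_zero not_le)
    then show ?thesis by blast
  qed
  finally have "num_alignments N ?S ?v = card (\<Union>k\<le>l. ?A k)" by (simp add: num_alignments_def)
  also have "\<dots> = (\<Sum>k\<le>l. card (?A k))"
  proof (rule card_UN_disjoint)
    have "dim_col M = k" if "M \<in> ?A k" for M k
      using that by (auto simp: one_two_alignments_def)
    then show "\<forall>i\<in>{..l}. \<forall>j\<in>{..l}. i \<noteq> j \<longrightarrow> ?A i \<inter> ?A j = {}" by blast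
  qed (use A in auto)
  finally show ?thesis by (simp add: A)
qed

section \<open>Local limit theorem for the binomial distribution\<close>

lemma has_bochner_integral_cis_int:
  fixes m :: int
  shows "has_bochner_integral lborel (\<lambda>t. indicator {-pi..pi} t *\<^sub>R cis (of_int m * t))
           (if m = 0 then 2 * pi else 0)"
proof (cases "m = 0")
  case True
  have "has_bochner_integral lborel (\<lambda>t. indicator {-pi..pi} t *\<^sub>R (1::complex)) (of_real pi - of_real (-pi))"
    by (rule has_bochner_integral_FTC_Icc) (auto intro!: derivative_eq_intros)
  with True show ?thesis by simp
next
  case False
  \<comment> \<open>This is \<open>cis (m * t) / (\<i> * m)\<close>, whose period divides 2 pi, so
    its values at the two endpoints agree.\<close>
  define F where "F t = Complex (sin (of_int m * t) / of_int m) (- cos (of_int m * t) / of_int m)" for t :: real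
  have "has_bochner_integral lborel (\<lambda>t. indicator {-pi..pi} t *\<^sub>R cis (of_int m * t)) (F pi - F (-pi))"
  proof (rule has_bochner_integral_FTC_Icc)
    fix x :: real
    show "(F has_vector_derivative cis (of_int m * x)) (at x within {-pi..pi})"
      using False unfolding F_def has_vector_derivative_complex_iff
      by (auto intro!: derivative_eq_intros)
  qed (auto intro!: continuous_intros)
  moreover have "F pi = F (-pi)"
    unfolding F_def by (simp add: complex_eq_iff sin_zero_iff_int2 mult.commute)
  ultimately show ?thesis using False by simp
qed

text \<open>Expanding the \<open>k\<close>-th power binomially gives a trigonometric polynomial,
  from which orthogonality of the characters extracts coefficient \<open>j\<close>. For
  \<open>j > k\<close> both sides are 0.\<close>

lemma has_bochner_integral_binomial_Fourier:
  fixes p q :: real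
  shows "has_bochner_integral lborel
     (\<lambda>t. indicator {-pi..pi} t *\<^sub>R ((of_real p * cis t + of_real q) ^ k * cis (- (real j * t))))
     (of_real (2 * pi * (real (k choose j) * p ^ j * q ^ (k - j))))"
proof -
  let ?c = "\<lambda>i. of_real (real (k choose i) * p ^ i * q ^ (k - i)) :: complex"
  have "has_bochner_integral lborel
     (\<lambda>t. \<Sum>i\<le>k. ?c i * (indicator {-pi..pi} t *\<^sub>R cis (of_int (int i - int j) * t)))
     (\<Sum>i\<le>k. ?c i * (if int i - int j = 0 then 2 * pi else 0))"
    by (intro has_bochner_integral_sum has_bochner_integral_mult_right has_bochner_integral_cis_int)
  also have "(\<lambda>t. \<Sum>i\<le>k. ?c i * (indicator {-pi..pi} t *\<^sub>R cis (of_int (int i - int j) * t)))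
     = (\<lambda>t. indicator {-pi..pi} t *\<^sub>R ((of_real p * cis t + of_real q) ^ k * cis (- (real j * t))))"
  proof
    fix t
    have "(of_real p * cis t + of_real q) ^ k * cis (- (real j * t)) =
        (\<Sum>i\<le>k. ?c i * cis (of_int (int i - int j) * t))"
      unfolding binomial_ring sum_distrib_right
      by (intro sum.cong) (auto simp: power_mult_distrib Complex.DeMoivre cis_mult algebra_simps)
    then show "(\<Sum>i\<le>k. ?c i * (indicator {-pi..pi} t *\<^sub>R cis (of_int (int i - int j) * t)))
       = indicator {-pi..pi} t *\<^sub>R ((of_real p * cis t + of_real q) ^ k * cis (- (real j * t)))"
      by (simp add: scaleR_sum_right)
  qed
  also have "(\<Sum>i\<le>k. ?c i * (if int i - int j = 0 then 2 * pi else 0)) =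
     (\<Sum>i\<le>k. if i = j then ?c i * (2 * pi) else 0)"
    by (intro sum.cong) auto
  also have "\<dots> = of_real (2 * pi * (real (k choose j) * p ^ j * q ^ (k - j)))"
    by (auto simp: binomial_eq_0)
  finally show ?thesis .
qed

text \<open>Characteristic function of \<open>X - p\<close> for a Bernoulli variable
  \<open>X\<close> with parameter \<open>p\<close>; centring removes the term linear in
  \<open>t\<close>.\<close>

definition bernoulli_char :: "real \<Rightarrow> real \<Rightarrow> complex" where
  "bernoulli_char p t = of_real (1 - p) * cis (- (p * t)) + of_real p * cis ((1 - p) * t)"

lemma bernoulli_char_altdef:
  "of_real p * cis t + of_real (1 - p) = cis (p * t) * bernoulli_char p t"
  by (simp add: bernoulli_char_def algebra_simps cis_mult)

lemma continuous_on_bernoulli_char [continuous_intros]: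
  "continuous_on A f \<Longrightarrow> continuous_on A (\<lambda>x. bernoulli_char p (f x))"
  unfolding bernoulli_char_def by (intro continuous_intros)

lemma borel_measurable_bernoulli_char [measurable]: "bernoulli_char p \<in> borel_measurable borel"
  by (intro borel_measurable_continuous_onI continuous_intros)

text \<open>Substitution of \<open>t = s / sqrt k\<close> in the previous Fourier integral. The
  phase split off by centring turns \<open>j\<close> into its deviation from the mean
  \<open>k * p\<close>, and the Jacobian supplies the factor \<open>sqrt k\<close>.\<close>

lemma has_bochner_integral_binomial_bernoulli_char:
  assumes "k > 0"
  shows "has_bochner_integral lborel
     (\<lambda>s. indicator {-pi * sqrt k..pi * sqrt k} s *\<^sub>R bernoulli_char p (s / sqrt k) ^ k
            * cis (- (s * ((real j - real k * p) / sqrt k))))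
     (of_real (2 * pi * (sqrt k * (real (k choose j) * p ^ j * (1 - p) ^ (k - j)))))"
proof -
  let ?f = "\<lambda>t. indicator {-pi..pi} t *\<^sub>R
     ((of_real p * cis t + of_real (1 - p)) ^ k * cis (- (real j * t)))"
  have "has_bochner_integral lborel (\<lambda>s. ?f (0 + inverse (sqrt k) * s))
     (of_real (2 * pi * (real (k choose j) * p ^ j * (1 - p) ^ (k - j))) /\<^sub>R \<bar>inverse (sqrt k)\<bar>)"
    by (rule lborel_has_bochner_integral_real_affine_iff [where t = 0 and c = "inverse (sqrt k)" and f = ?f,
          THEN iffD1, OF _ has_bochner_integral_binomial_Fourier]) (use assms in simp)
  also have "(\<lambda>s. ?f (0 + inverse (sqrt k) * s)) =
     (\<lambda>s. indicator {-pi * sqrt k..pi * sqrt k} s *\<^sub>R bernoulli_char p (s / sqrt k) ^ k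
            * cis (- (s * ((real j - real k * p) / sqrt k))))"
  proof
    fix s
    have "indicator {-pi..pi} (s / sqrt k) = (indicator {-pi * sqrt k..pi * sqrt k} s :: real)"
      using assms by (auto simp: indicator_def field_simps)
    moreover have "(of_real p * cis (s / sqrt k) + of_real (1 - p)) ^ k * cis (- (real j * (s / sqrt k)))
       = bernoulli_char p (s / sqrt k) ^ k * cis (- (s * ((real j - real k * p) / sqrt k)))"
      unfolding bernoulli_char_altdef power_mult_distrib Complex.DeMoivre
      by (simp add: cis_mult diff_divide_distrib algebra_simps)
    ultimately show "?f (0 + inverse (sqrt k) * s) =
       indicator {-pi * sqrt k..pi * sqrt k} s *\<^sub>R bernoulli_char p (s / sqrt k) ^ k
            * cis (- (s * ((real j - real k * p) / sqrt k)))"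
      by (simp add: field_simps)
  qed
  finally show ?thesis by (simp add: scaleR_conv_of_real mult_ac)
qed

text \<open>The Gaussian counterpart, with the same oscillating factor, so that the two integrands
  can be subtracted. It is the characteristic function of the standard normal law after the scaling
  \<open>x = \<sigma> * s\<close>.\<close>

lemma has_bochner_integral_normal_density_Fourier:
  assumes "\<sigma> > 0"
  shows "has_bochner_integral lborel (\<lambda>s. of_real (exp (- (\<sigma>\<^sup>2 * s\<^sup>2 / 2))) * cis (- (s * y)))
           (of_real (2 * pi * normal_density 0 \<sigma> y))"
proof -
  let ?f = "\<lambda>x. std_normal_density x *\<^sub>R cis (- (y / \<sigma>) * x)"
  have meas: "?f \<in> borel_measurable borel"
    by (intro borel_measurable_scaleR borel_measurable_normal_density
         borel_measurable_continuous_onI continuous_intros)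
  have int: "integrable lborel ?f"
    by (rule Bochner_Integration.integrable_bound [where f = std_normal_density]) (use meas in auto)
  have "(LINT x|lborel. ?f x) = char std_normal_distribution (- (y / \<sigma>))"
    unfolding char_def by (subst integral_density) (auto simp: cis_conv_exp)
  also have "\<dots> = of_real (exp (- ((y / \<sigma>)\<^sup>2) / 2))"
    by (simp add: char_std_normal_distribution)
  finally have "has_bochner_integral lborel ?f (of_real (exp (- ((y / \<sigma>)\<^sup>2) / 2)))"
    using int by (simp add: has_bochner_integral_iff)
  then have "has_bochner_integral lborel (\<lambda>s. ?f (0 + \<sigma> * s)) (of_real (exp (- ((y / \<sigma>)\<^sup>2) / 2)) /\<^sub>R \<bar>\<sigma>\<bar>)"
    using assms by (subst lborel_has_bochner_integral_real_affine_iff [symmetric]) auto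
  then have "has_bochner_integral lborel (\<lambda>s. of_real (sqrt (2 * pi)) * ?f (0 + \<sigma> * s))
      (of_real (sqrt (2 * pi)) * (of_real (exp (- ((y / \<sigma>)\<^sup>2) / 2)) /\<^sub>R \<bar>\<sigma>\<bar>))"
    by (rule has_bochner_integral_mult_right)
  also have "(\<lambda>s. of_real (sqrt (2 * pi)) * ?f (0 + \<sigma> * s)) =
      (\<lambda>s. of_real (exp (- (\<sigma>\<^sup>2 * s\<^sup>2 / 2))) * cis (- (s * y)))"
    using assms by (auto simp: fun_eq_iff std_normal_density_def scaleR_conv_of_real power_mult_distrib mult_ac)
  also have "sqrt (2 * pi) / \<sigma> = 2 * pi * (1 / sqrt (2 * pi * \<sigma>\<^sup>2))"
    using assms by (simp add: real_sqrt_mult field_simps)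
  then have "of_real (sqrt (2 * pi)) * (of_real (exp (- ((y / \<sigma>)\<^sup>2) / 2)) /\<^sub>R \<bar>\<sigma>\<bar>) =
     (of_real (2 * pi * normal_density 0 \<sigma> y) :: complex)"
    using assms
    by (simp add: normal_density_def scaleR_conv_of_real power_divide field_simps flip: of_real_mult of_real_divide)
  finally show ?thesis .
qed

section \<open>Decay and expansion of the characteristic function\<close>

lemma one_minus_cos_ge:
  fixes t :: real
  assumes "\<bar>t\<bar> \<le> pi"
  shows "t\<^sup>2 / 18 \<le> 1 - cos t"
proof -
  \<comment> \<open>With \<open>u = \<bar>t\<bar> / 2\<close>, \<open>1 - cos t\<close> is
    \<open>2 * (sin u)^2\<close>. Taylor's bound \<open>sin u \<ge> u - u^3 / 6\<close> and
    \<open>u^3 \<le> 4 * u\<close> for \<open>u \<le> 2\<close> give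
    \<open>sin u \<ge> u / 3\<close>, whence the constant 18.\<close>
  define u where "u = \<bar>t\<bar> / 2"
  have u: "0 \<le> u" "u \<le> 2" using assms pi_less_4 by (auto simp: u_def)
  have "\<bar>sin u - (\<Sum>m<3. sin_coeff m * u ^ m)\<bar> \<le> inverse (fact 3) * \<bar>u\<bar> ^ 3"
    by (rule Maclaurin_sin_bound)
  then have "\<bar>sin u - u\<bar> \<le> u ^ 3 / 6"
    using u by (simp add: eval_nat_numeral sin_coeff_def)
  then have "u - u ^ 3 / 6 \<le> sin u" using abs_ge_minus_self[of "sin u - u"] by linarith
  moreover have "u ^ 3 \<le> 4 * u"
    using u mult_mono[of u 2 u 2] mult_right_mono[of "u * u" 4 u] by (simp add: eval_nat_numeral)
  ultimately have "u / 3 \<le> sin u" by linarith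
  then have "(u / 3)\<^sup>2 \<le> (sin u)\<^sup>2" using u by (intro power_mono) auto
  moreover have "cos t = 1 - 2 * (sin u)\<^sup>2"
    using cos_double_sin[of u] by (simp add: u_def)
  ultimately show ?thesis by (simp add: u_def power_divide)
qed

lemma norm_bernoulli_char_le_1:
  assumes "0 \<le> p" "p \<le> 1"
  shows "norm (bernoulli_char p t) \<le> 1"
  unfolding bernoulli_char_def
  by (rule order_trans[OF norm_triangle_ineq]) (use assms in \<open>simp add: norm_mult del: of_real_diff\<close>)

text \<open>The squared modulus is \<open>1 - 2 * p * (1 - p) * (1 - cos t)\<close>, to which
  \<open>1 + x \<le> exp x\<close> applies. At \<open>t = s / sqrt k\<close> the \<open>k\<close>-th
  power of the bound no longer depends on \<open>k\<close>, as dominated convergence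
  requires.\<close>

lemma norm_bernoulli_char_le:
  assumes "0 \<le> p" "p \<le> 1" "\<bar>t\<bar> \<le> pi"
  shows "norm (bernoulli_char p t) \<le> exp (- (p * (1 - p) * t\<^sup>2 / 18))"
proof -
  have "(norm (bernoulli_char p t))\<^sup>2 = (norm (of_real p * cis t + of_real (1 - p)))\<^sup>2"
    by (simp only: bernoulli_char_altdef norm_mult norm_cis mult_1)
  also have "\<dots> = (p * cos t + (1 - p))\<^sup>2 + (p * sin t)\<^sup>2"
    by (simp add: cmod_power2)
  also have "\<dots> = 1 - 2 * (p * (1 - p)) * (1 - cos t)"
    by (simp add: power_mult_distrib sin_squared_eq) (simp add: power2_eq_square algebra_simps)
  also have "\<dots> \<le> 1 - 2 * (p * (1 - p)) * (t\<^sup>2 / 18)"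
    using assms one_minus_cos_ge[of t] by (intro diff_left_mono mult_left_mono) auto
  also have "\<dots> \<le> exp (- (2 * (p * (1 - p)) * (t\<^sup>2 / 18)))"
    using exp_ge_add_one_self[of "- (2 * (p * (1 - p)) * (t\<^sup>2 / 18))"] by simp
  also have "\<dots> = (exp (- (p * (1 - p) * t\<^sup>2 / 18)))\<^sup>2"
    by (simp add: exp_double [symmetric])
  finally show ?thesis by (rule power2_le_imp_le) simp
qed

lemma cis_approx:
  fixes x :: real
  shows "norm (cis x - (1 + \<i> * x - of_real (x\<^sup>2) / 2)) \<le> \<bar>x\<bar> ^ 3 / 6"
  using iexp_approx1[of x 2] by (simp add: cis_conv_exp eval_nat_numeral power_mult_distrib algebra_simps)

text \<open>Second-order expansion of both exponentials: the linear terms cancel and the quadratic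
  ones add up to the variance \<open>p * (1 - p)\<close>.\<close>

lemma bernoulli_char_approx:
  assumes "0 \<le> p" "p \<le> 1"
  shows "norm (bernoulli_char p t - of_real (1 - p * (1 - p) * t\<^sup>2 / 2)) \<le> \<bar>t\<bar> ^ 3"
proof -
  let ?r = "\<lambda>x::real. cis x - (1 + \<i> * x - of_real (x\<^sup>2) / 2)"
  have "bernoulli_char p t - of_real (1 - p * (1 - p) * t\<^sup>2 / 2) =
      of_real (1 - p) * ?r (- (p * t)) + of_real p * ?r ((1 - p) * t)"
    by (simp add: bernoulli_char_def field_simps power2_eq_square)
  also have "norm \<dots> \<le> (1 - p) * norm (?r (- (p * t))) + p * norm (?r ((1 - p) * t))"
    by (rule order_trans[OF norm_triangle_ineq]) (use assms in \<open>simp add: norm_mult del: of_real_diff\<close>)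
  also have "\<dots> \<le> (1 - p) * \<bar>t\<bar> ^ 3 + p * \<bar>t\<bar> ^ 3"
  proof -
    have *: "norm (?r x) \<le> \<bar>t\<bar> ^ 3" if "\<bar>x\<bar> \<le> \<bar>t\<bar>" for x
    proof -
      have "\<bar>x\<bar> ^ 3 \<le> \<bar>t\<bar> ^ 3" using that by (intro power_mono) auto
      then show ?thesis using cis_approx[of x] zero_le_power[of "\<bar>x\<bar>" 3] by linarith
    qed
    show ?thesis
      by (intro add_mono mult_left_mono *) (use assms in \<open>auto simp: abs_mult mult_left_le_one_le\<close>)
  qed
  also have "\<dots> = \<bar>t\<bar> ^ 3" by (simp add: algebra_simps)
  finally show ?thesis .
qed

text \<open>Comparison with \<open>(1 - c / k)^k\<close>, which tends to \<open>exp (- c)\<close>.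
  In the unit disc \<open>k\<close>-th powers differ by at most \<open>k\<close> times the
  difference of the bases, here at most \<open>k * \<bar>s / sqrt k\<bar>^3\<close>, which tends to
  0.\<close>

lemma bernoulli_char_power_tendsto:
  assumes "0 \<le> p" "p \<le> 1"
  shows "(\<lambda>k. bernoulli_char p (s / sqrt k) ^ k) \<longlonglongrightarrow> of_real (exp (- (p * (1 - p) * s\<^sup>2 / 2)))"
proof -
  define c where "c = p * (1 - p) * s\<^sup>2 / 2"
  define z where "z k = complex_of_real (1 + (- c) / real k)" for k
  have "(\<lambda>k. z k ^ k) \<longlonglongrightarrow> of_real (exp (- c))"
    unfolding z_def of_real_power [symmetric]
    by (rule tendsto_of_real tendsto_exp_limit_sequentially)+
  moreover have "(\<lambda>k. bernoulli_char p (s / sqrt k) ^ k - z k ^ k) \<longlonglongrightarrow> 0"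
  proof (rule Lim_null_comparison)
    show "(\<lambda>k. \<bar>s\<bar> ^ 3 * inverse (sqrt (real k))) \<longlonglongrightarrow> 0"
      by (intro tendsto_mult_right_zero tendsto_inverse_0_at_top
           filterlim_compose[OF sqrt_at_top] filterlim_real_sequentially)
    \<comment> \<open>From \<open>c \<le> k\<close> on, \<open>1 - c / k\<close> lies in [0, 1], as
      the comparison of powers requires.\<close>
    obtain K :: nat where K: "c \<le> K" using real_arch_simple by blast
    show "\<forall>\<^sub>F k in sequentially. norm (bernoulli_char p (s / sqrt k) ^ k - z k ^ k)
            \<le> \<bar>s\<bar> ^ 3 * inverse (sqrt (real k))"
      using eventually_ge_at_top[of "Suc K"]
    proof eventually_elim
      case (elim k)
      have k: "k > 0" "c \<le> k" using elim K by auto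
      have "0 \<le> c" using assms by (auto simp: c_def)
      then have "norm (z k) \<le> 1"
        unfolding z_def norm_of_real using k by (auto simp: abs_le_iff field_simps)
      then have "norm (bernoulli_char p (s / sqrt k) ^ k - z k ^ k)
          \<le> k * norm (bernoulli_char p (s / sqrt k) - z k)"
        by (intro norm_power_diff norm_bernoulli_char_le_1 assms)
      also have "\<dots> \<le> k * \<bar>s / sqrt k\<bar> ^ 3"
      proof (rule mult_left_mono)
        have "z k = of_real (1 - p * (1 - p) * (s / sqrt k)\<^sup>2 / 2)"
          using k by (simp add: z_def c_def power_divide)
        then show "norm (bernoulli_char p (s / sqrt k) - z k) \<le> \<bar>s / sqrt k\<bar> ^ 3"
          using bernoulli_char_approx[OF assms] by (simp only:)
      qed simp
      also have "\<dots> = \<bar>s\<bar> ^ 3 * inverse (sqrt (real k))"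
        using k by (simp add: power_divide eval_nat_numeral field_simps)
      finally show ?case .
    qed
  qed
  ultimately show ?thesis
    unfolding c_def by (rule Lim_transform)
qed

lemma has_bochner_integral_exp_minus_square:
  fixes a :: real
  assumes "a > 0"
  shows "has_bochner_integral lborel (\<lambda>s. exp (- (a * s\<^sup>2))) (sqrt (pi / a))"
proof -
  \<comment> \<open>The variance for which the exponent of the normal density is
    \<open>- a * s^2\<close>.\<close>
  define \<sigma> where "\<sigma> = sqrt (1 / (2 * a))"
  have \<sigma>: "\<sigma> > 0" "\<sigma>\<^sup>2 = 1 / (2 * a)" using assms by (auto simp: \<sigma>_def)
  have "has_bochner_integral lborel (\<lambda>s. sqrt (pi / a) * normal_density 0 \<sigma> s) (sqrt (pi / a) * 1)"
    using \<sigma> by (intro has_bochner_integral_mult_right) (simp add: has_bochner_integral_iff)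
  also have "(\<lambda>s. sqrt (pi / a) * normal_density 0 \<sigma> s) = (\<lambda>s. exp (- (a * s\<^sup>2)))"
    using assms \<sigma> by (auto simp: normal_density_def fun_eq_iff mult_ac)
  finally show ?thesis by simp
qed

text \<open>The error is uniform in \<open>j\<close>: the index enters the two Fourier integrals
  only through a factor of modulus 1, so their difference is bounded by an L1 distance that depends
  on \<open>k\<close> alone.\<close>

theorem binomial_local_limit:
  assumes "0 < p" "p < 1"
  obtains e :: "nat \<Rightarrow> real" where "e \<longlonglongrightarrow> 0"
    "\<And>k j. k > 0 \<Longrightarrow> \<bar>sqrt k * (real (k choose j) * p ^ j * (1 - p) ^ (k - j))
       - normal_density 0 (sqrt (p * (1 - p))) ((real j - real k * p) / sqrt k)\<bar> \<le> e k"
proof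
  define \<sigma> where "\<sigma> = sqrt (p * (1 - p))"
  have \<sigma>: "\<sigma> > 0" "\<sigma>\<^sup>2 = p * (1 - p)" using assms by (auto simp: \<sigma>_def)
  define f where "f k s = indicator {-pi * sqrt k..pi * sqrt k} s *\<^sub>R bernoulli_char p (s / sqrt k) ^ k" for k :: nat and s
  define g where "g s = complex_of_real (exp (- (\<sigma>\<^sup>2 * s\<^sup>2 / 2)))" for s
  define D where "D k = (LINT s|lborel. norm (f k s - g s))" for k
  define e where "e k = D k / (2 * pi)" for k
  have [measurable]: "f k \<in> borel_measurable borel" "g \<in> borel_measurable borel" for k
    unfolding f_def g_def by measurable
  have gauss: "integrable lborel (\<lambda>s. exp (- (a * s\<^sup>2)))" if "a > 0" for a :: real
    using has_bochner_integral_exp_minus_square[OF that] by (simp add: has_bochner_integral_iff)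
  have f_le: "norm (f k s) \<le> exp (- (\<sigma>\<^sup>2 / 18 * s\<^sup>2))" for k s
  proof (cases "k > 0 \<and> \<bar>s\<bar> \<le> pi * sqrt k")
    case True
    then have "norm (bernoulli_char p (s / sqrt k)) \<le> exp (- (p * (1 - p) * (s / sqrt k)\<^sup>2 / 18))"
      using assms by (intro norm_bernoulli_char_le) (auto simp: field_simps abs_le_iff)
    then have "norm (bernoulli_char p (s / sqrt k) ^ k) \<le> exp (- (p * (1 - p) * (s / sqrt k)\<^sup>2 / 18)) ^ k"
      unfolding norm_power by (intro power_mono) auto
    also have "\<dots> = exp (- (\<sigma>\<^sup>2 / 18 * s\<^sup>2))"
      using True by (simp add: \<sigma> power_divide flip: exp_of_nat_mult)
    finally have "norm (bernoulli_char p (s / sqrt k) ^ k) \<le> exp (- (\<sigma>\<^sup>2 / 18 * s\<^sup>2))" .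
    moreover have "norm (f k s) \<le> norm (bernoulli_char p (s / sqrt k) ^ k)"
      unfolding f_def norm_scaleR by (intro mult_left_le_one_le) (auto simp: indicator_def)
    ultimately show ?thesis by (rule order_trans[rotated])
  next
    case False
    \<comment> \<open>For \<open>k = 0\<close> the interval shrinks to the point 0, where
      \<open>f\<close> is 1 and so is the bound.\<close>
    then have "f k s = 0 \<or> s = 0 \<and> k = 0" by (auto simp: f_def indicator_def abs_le_iff)
    then show ?thesis by (elim disjE conjE) (simp, simp add: f_def)
  qed
  have f_int: "integrable lborel (f k)" for k
    by (rule Bochner_Integration.integrable_bound [OF gauss[of "\<sigma>\<^sup>2 / 18"]]) (use f_le \<sigma>(1) in auto)
  have g_int: "integrable lborel g"
    unfolding g_def using gauss[of "\<sigma>\<^sup>2 / 2"] \<sigma>(1) by (intro integrable_of_real) auto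
  have f_lim: "(\<lambda>k. f k s) \<longlonglongrightarrow> g s" for s
  proof (rule Lim_transform_eventually)
    show "(\<lambda>k. bernoulli_char p (s / sqrt k) ^ k) \<longlonglongrightarrow> g s"
      unfolding g_def \<sigma> using assms by (intro bernoulli_char_power_tendsto) auto
    have "filterlim (\<lambda>k. pi * sqrt (real k)) at_top sequentially"
      by (intro filterlim_tendsto_pos_mult_at_top[OF tendsto_const]
           filterlim_compose[OF sqrt_at_top] filterlim_real_sequentially) auto
    then have "\<forall>\<^sub>F k in sequentially. \<bar>s\<bar> \<le> pi * sqrt (real k)"
      by (simp add: filterlim_at_top)
    then show "\<forall>\<^sub>F k in sequentially. bernoulli_char p (s / sqrt k) ^ k = f k s"
      by eventually_elim (auto simp: f_def indicator_def abs_le_iff)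
  qed
  \<comment> \<open>Dominated convergence: the integrand tends to 0 pointwise by
    \<open>f_lim\<close> and is bounded through \<open>f_le\<close> by an integrable function free
    of \<open>k\<close>.\<close>
  have "D \<longlonglongrightarrow> (LINT s|(lborel :: real measure). 0)"
    unfolding D_def
  proof (rule integral_dominated_convergence)
    show "integrable lborel (\<lambda>s. exp (- (\<sigma>\<^sup>2 / 18 * s\<^sup>2)) + norm (g s))"
      using gauss[of "\<sigma>\<^sup>2 / 18"] \<sigma>(1) g_int by auto
    show "AE s in lborel. (\<lambda>k. norm (f k s - g s)) \<longlonglongrightarrow> 0"
      using f_lim by (auto intro!: tendsto_norm_zero simp flip: Lim_null)
    show "AE s in lborel. norm (norm (f k s - g s)) \<le> exp (- (\<sigma>\<^sup>2 / 18 * s\<^sup>2)) + norm (g s)" for k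
      using f_le by (intro AE_I2) (simp add: norm_triangle_le_diff add_mono)
  qed auto
  then have "(\<lambda>k. D k / (2 * pi)) \<longlonglongrightarrow> 0 / (2 * pi)"
    by (intro tendsto_intros) auto
  then show "e \<longlonglongrightarrow> 0" by (simp add: e_def[abs_def])
  show "\<bar>sqrt k * (real (k choose j) * p ^ j * (1 - p) ^ (k - j))
       - normal_density 0 (sqrt (p * (1 - p))) ((real j - real k * p) / sqrt k)\<bar> \<le> e k" if "k > 0" for k j
  proof -
    define y where "y = (real j - real k * p) / sqrt k"
    define b where "b = sqrt k * (real (k choose j) * p ^ j * (1 - p) ^ (k - j))"
    have "has_bochner_integral lborel (\<lambda>s. f k s * cis (- (s * y)) - g s * cis (- (s * y)))
       (of_real (2 * pi * b) - of_real (2 * pi * normal_density 0 \<sigma> y))"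
      unfolding f_def g_def y_def b_def
      by (intro has_bochner_integral_diff has_bochner_integral_binomial_bernoulli_char
           has_bochner_integral_normal_density_Fourier that \<sigma>)
    then have "norm (of_real (2 * pi * b) - complex_of_real (2 * pi * normal_density 0 \<sigma> y))
        = norm (LINT s|lborel. f k s * cis (- (s * y)) - g s * cis (- (s * y)))"
      by (simp only: has_bochner_integral_iff)
    also have "\<dots> \<le> (LINT s|lborel. norm (f k s * cis (- (s * y)) - g s * cis (- (s * y))))"
      by (rule integral_norm_bound)
    also have "\<dots> = D k"
      by (simp add: D_def norm_mult flip: left_diff_distrib)
    also have "of_real (2 * pi * b) - complex_of_real (2 * pi * normal_density 0 \<sigma> y)
        = of_real (2 * pi * (b - normal_density 0 \<sigma> y))"
      by (simp add: algebra_simps)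
    finally have "2 * pi * \<bar>b - normal_density 0 \<sigma> y\<bar> \<le> D k"
      by (simp only: norm_of_real abs_mult) simp
    then show ?thesis
      unfolding b_def [symmetric] y_def [symmetric] \<sigma>_def [symmetric] e_def
      by (simp add: field_simps)
  qed
qed

lemma normal_density_le:
  assumes "\<sigma> > 0"
  shows "normal_density \<mu> \<sigma> x \<le> 1 / sqrt (2 * pi * \<sigma>\<^sup>2)"
  using assms by (simp add: normal_density_def divide_right_mono)

text \<open>The error sequence converges, hence is bounded, and the normal density is bounded by its
  peak; for \<open>k = 0\<close> the factor \<open>sqrt k\<close> is 0.\<close>

corollary binomial_prob_bound:
  assumes "0 < p" "p < 1"
  obtains C :: real where "C > 0"
    "\<And>k j. sqrt k * (real (k choose j) * p ^ j * (1 - p) ^ (k - j)) \<le> C"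
proof -
  define \<sigma> where "\<sigma> = sqrt (p * (1 - p))"
  have \<sigma>: "\<sigma> > 0" using assms by (simp add: \<sigma>_def)
  obtain e :: "nat \<Rightarrow> real" where e: "e \<longlonglongrightarrow> 0"
    "\<And>k j. k > 0 \<Longrightarrow> \<bar>sqrt k * (real (k choose j) * p ^ j * (1 - p) ^ (k - j))
       - normal_density 0 \<sigma> ((real j - real k * p) / sqrt k)\<bar> \<le> e k"
    using binomial_local_limit[OF assms] unfolding \<sigma>_def by blast
  obtain K where K: "K > 0" "\<And>k. norm (e k) \<le> K"
    using convergent_imp_Bseq[OF convergentI[OF e(1)]] by (auto elim: BseqE)
  show thesis
  proof
    show "1 / sqrt (2 * pi * \<sigma>\<^sup>2) + K > 0" using \<sigma> K by (simp add: add_pos_pos)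
    show "sqrt k * (real (k choose j) * p ^ j * (1 - p) ^ (k - j)) \<le> 1 / sqrt (2 * pi * \<sigma>\<^sup>2) + K" for k j
    proof (cases "k = 0")
      case False
      then show ?thesis
        using e(2)[of k j] K(2)[of k] normal_density_le[OF \<sigma>, of 0 "(real j - real k * p) / sqrt k"]
        unfolding real_norm_def by linarith
    qed (use \<sigma> K in \<open>simp add: add_nonneg_nonneg less_imp_le\<close>)
  qed
qed

section \<open>Convergence of sums of powers\<close>

text \<open>Each integer \<open>k\<close> is the floor on an interval of length
  \<open>1 / b\<close>.\<close>

lemma has_bochner_integral_floor:
  fixes h :: "int \<Rightarrow> real"
  assumes "b > 0" "finite I" "\<And>k. k \<notin> I \<Longrightarrow> h k = 0"
  shows "has_bochner_integral lborel (\<lambda>x. h \<lfloor>a + b * x\<rfloor>) ((\<Sum>k\<in>I. h k) / b)"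
proof -
  have "has_bochner_integral lborel (indicator {real_of_int k..<real_of_int k + 1} :: real \<Rightarrow> real) 1" for k
    using has_bochner_integral_real_indicator[of "{real_of_int k..<real_of_int k + 1}" lborel] by simp
  then have "has_bochner_integral lborel
      (\<lambda>x. \<Sum>k\<in>I. h k * indicator {real_of_int k..<real_of_int k + 1} x) (\<Sum>k\<in>I. h k * 1)"
    by (intro has_bochner_integral_sum has_bochner_integral_mult_right)
  also have "(\<lambda>x. \<Sum>k\<in>I. h k * indicator {real_of_int k..<real_of_int k + 1} x) = (\<lambda>x. h \<lfloor>x\<rfloor>)"
  proof
    fix x :: real
    have "(\<Sum>k\<in>I. h k * indicator {real_of_int k..<real_of_int k + 1} x)
        = (\<Sum>k\<in>I. if k = \<lfloor>x\<rfloor> then h k else 0)"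
      by (intro sum.cong) (auto simp: indicator_def floor_eq_iff eq_commute[of _ "\<lfloor>x\<rfloor>"])
    also have "\<dots> = h \<lfloor>x\<rfloor>" using assms by auto
    finally show "(\<Sum>k\<in>I. h k * indicator {real_of_int k..<real_of_int k + 1} x) = h \<lfloor>x\<rfloor>" .
  qed
  finally show ?thesis
    using assms lborel_has_bochner_integral_real_affine_iff[of b "\<lambda>x. h \<lfloor>x\<rfloor>" "\<Sum>k\<in>I. h k" a]
    by (simp add: divide_inverse mult.commute)
qed

text \<open>Pointwise convergence together with convergence of the integrals yields L1 convergence
  by Scheffe; the uniform bound makes the \<open>N\<close>-th power Lipschitz on the range of the
  functions, so L1 convergence survives.\<close>

lemma integral_power_tendsto:
  fixes f :: "nat \<Rightarrow> 'a \<Rightarrow> real"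
  assumes f: "\<And>n. integrable M (f n)" and g: "integrable M g"
    and bounds: "\<And>n x. 0 \<le> f n x" "\<And>n x. f n x \<le> C"
    and lim: "\<And>x. (\<lambda>n. f n x) \<longlonglongrightarrow> g x"
    and int: "(\<lambda>n. \<integral>x. f n x \<partial>M) \<longlonglongrightarrow> (\<integral>x. g x \<partial>M)"
    and N: "N > 0"
  shows "(\<lambda>n. \<integral>x. f n x ^ N \<partial>M) \<longlonglongrightarrow> (\<integral>x. g x ^ N \<partial>M)"
proof -
  have g_bounds: "0 \<le> g x" "g x \<le> C" for x
    using bounds by (auto intro!: LIMSEQ_le_const[OF lim] LIMSEQ_le_const2[OF lim])
  \<comment> \<open>Division by \<open>D\<close> must be possible and must bring all values into
    [0, 1]; \<open>C\<close> itself might be 0.\<close>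
  define D where "D = max C 1"
  have D: "D > 0" "C \<le> D" by (auto simp: D_def)
  have [measurable]: "f n \<in> borel_measurable M" "g \<in> borel_measurable M" for n
    using f g by auto
  have power_int: "integrable M (\<lambda>x. u x ^ N)"
    if "integrable M u" "\<And>x. 0 \<le> u x" "\<And>x. u x \<le> C" for u
  proof (rule Bochner_Integration.integrable_bound[of M "\<lambda>x. D ^ (N - 1) * u x"])
    have "u x ^ N \<le> D ^ (N - 1) * u x" for x
    proof -
      have "u x ^ (N - 1) * u x \<le> D ^ (N - 1) * u x"
        using that D by (intro mult_right_mono power_mono) (auto intro: order_trans)
      then show ?thesis using N by (cases N) (auto simp: mult.commute)
    qed
    then show "AE x in M. norm (u x ^ N) \<le> norm (D ^ (N - 1) * u x)"
      using that D by (intro AE_I2) auto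
  qed (use that in auto)
  have "(\<lambda>n. \<integral>\<^sup>+ x. norm (f n x) \<partial>M) \<longlonglongrightarrow> (\<integral>\<^sup>+ x. norm (g x) \<partial>M)"
    using int by (simp add: nn_integral_eq_integral f g bounds g_bounds)
  then have "limsup (\<lambda>n. \<integral>\<^sup>+ x. norm (f n x) \<partial>M) = (\<integral>\<^sup>+ x. norm (g x) \<partial>M)"
    by (rule lim_imp_Limsup [rotated]) simp
  then have "(\<lambda>n. \<integral>\<^sup>+ x. norm (f n x - g x) \<partial>M) \<longlonglongrightarrow> 0"
    using lim by (intro Scheffe_lemma1 f g) auto
  moreover have "(\<integral>\<^sup>+ x. norm (f n x - g x) \<partial>M) = ennreal (\<integral>x. norm (f n x - g x) \<partial>M)" for n
    using f g by (intro nn_integral_eq_integral) auto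
  ultimately have "(\<lambda>n. ennreal (\<integral>x. norm (f n x - g x) \<partial>M)) \<longlonglongrightarrow> ennreal 0"
    by simp
  then have L1: "(\<lambda>n. \<integral>x. norm (f n x - g x) \<partial>M) \<longlonglongrightarrow> 0"
    by (subst (asm) tendsto_ennreal_iff) auto
  \<comment> \<open>This is \<open>N * D ^ (N - 1)\<close>, the Lipschitz constant of the
    \<open>N\<close>-th power on [0, \<open>D\<close>].\<close>
  define E where "E = D ^ N * (real N / D)"
  have "(\<lambda>n. (\<integral>x. f n x ^ N \<partial>M) - (\<integral>x. g x ^ N \<partial>M)) \<longlonglongrightarrow> 0"
  proof (rule Lim_null_comparison)
    show "(\<lambda>n. E * (\<integral>x. norm (f n x - g x) \<partial>M)) \<longlonglongrightarrow> 0"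
      using tendsto_mult_right_zero[OF L1] .
    show "\<forall>\<^sub>F n in sequentially. norm ((\<integral>x. f n x ^ N \<partial>M) - (\<integral>x. g x ^ N \<partial>M))
             \<le> E * (\<integral>x. norm (f n x - g x) \<partial>M)"
    proof (rule always_eventually, rule allI)
      fix n
      have "norm ((\<integral>x. f n x ^ N \<partial>M) - (\<integral>x. g x ^ N \<partial>M)) = norm (\<integral>x. f n x ^ N - g x ^ N \<partial>M)"
        using f g bounds g_bounds by (simp add: power_int)
      also have "\<dots> \<le> (\<integral>x. norm (f n x ^ N - g x ^ N) \<partial>M)"
        by (rule integral_norm_bound)
      also have "\<dots> \<le> (\<integral>x. E * norm (f n x - g x) \<partial>M)"
      proof (rule integral_mono)
        fix x
        have "norm ((f n x / D) ^ N - (g x / D) ^ N) \<le> N * norm (f n x / D - g x / D)"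
          using D bounds[of n x] g_bounds[of x] by (intro norm_power_diff) auto
        then have "D ^ N * norm ((f n x / D) ^ N - (g x / D) ^ N) \<le> D ^ N * (N * norm (f n x / D - g x / D))"
          using D by (intro mult_left_mono) auto
        then show "norm (f n x ^ N - g x ^ N) \<le> E * norm (f n x - g x)"
          using D by (simp add: E_def power_divide flip: diff_divide_distrib)
      qed (use f g bounds g_bounds in \<open>auto simp: power_int\<close>)
      finally show "norm ((\<integral>x. f n x ^ N \<partial>M) - (\<integral>x. g x ^ N \<partial>M)) \<le> E * (\<integral>x. norm (f n x - g x) \<partial>M)"
        by simp
    qed
  qed
  then show ?thesis by (rule LIM_zero_cancel)
qed

text \<open>Shallow diagonals of Pascal's triangle, read in the opposite direction.\<close>

lemma sum_choose_fib: "(\<Sum>k\<le>l. k choose (l - k)) = fib (Suc l)"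
proof -
  have "(\<Sum>k\<le>l. k choose (l - k)) = (\<Sum>k\<le>l. (l - k) choose k)"
    by (rule sum.reindex_bij_witness[where i = "\<lambda>k. l - k" and j = "\<lambda>k. l - k"]) auto
  then show ?thesis by (simp add: ne_diagonal_fib atMost_atLeast0)
qed

section \<open>The random walk with golden-ratio step probabilities\<close>

locale golden =
  fixes \<phi> :: real
  assumes phi: "\<phi> = (sqrt 5 - 1) / 2"
begin

lemma phi_bounds: "0 < \<phi>" "\<phi> < 1"
  by (auto simp: phi real_less_rsqrt real_less_lsqrt)

lemma phi_square: "\<phi>\<^sup>2 = 1 - \<phi>"
  by (simp add: phi power2_eq_square field_simps)

lemma sqrt_5: "sqrt 5 = 1 + 2 * \<phi>"
  unfolding phi by (simp add: field_simps)

text \<open>The mean step \<phi> + 2 \<phi>^2, in the form in which it arises from the Fibonacci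
  asymptotics.\<close>

definition \<mu> :: real where "\<mu> = \<phi> * sqrt 5"

lemma mu_altdef: "\<mu> = 1 + \<phi>\<^sup>2"
  using phi_square by (simp add: \<mu>_def sqrt_5 power2_eq_square algebra_simps)

lemma mu_gt_1: "\<mu> > 1"
  using phi_bounds by (simp add: mu_altdef)

text \<open>The probability that a random walk with steps 1 and 2, of probabilities \<open>\<phi>\<close> and \<open>\<phi>\<^sup>2\<close>,
  is at \<open>l\<close> after \<open>k\<close> steps.\<close>
definition hit_prob :: "nat \<Rightarrow> nat \<Rightarrow> real" where
  "hit_prob l k = real (k choose (l - k)) * \<phi> ^ l"

text \<open>Reaching \<open>l\<close> in \<open>k\<close> steps takes \<open>l - k\<close> twos,
  each of probability \<phi>^2, and ones of probability 1 - \<phi>^2 = \<phi> otherwise. If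
  \<open>l - k > k\<close>, both sides vanish.\<close>

lemma hit_prob_binomial:
  assumes "k \<le> l"
  shows "hit_prob l k = real (k choose (l - k)) * (\<phi>\<^sup>2) ^ (l - k) * (1 - \<phi>\<^sup>2) ^ (k - (l - k))"
proof (cases "l - k \<le> k")
  case True
  then have "l = 2 * (l - k) + (k - (l - k))" using assms by simp
  then have "\<phi> ^ l = (\<phi>\<^sup>2) ^ (l - k) * \<phi> ^ (k - (l - k))"
    by (metis power_add power_mult)
  then show ?thesis by (simp add: hit_prob_def phi_square)
qed (simp add: hit_prob_def binomial_eq_0)

text \<open>The sum is \<open>fib (Suc l) * \<phi> ^ l\<close>, and \<phi> is the inverse of the
  growth rate of the Fibonacci numbers. The limit is the mass that Scheffe's lemma needs.\<close>

lemma sum_hit_prob_tendsto: "(\<lambda>l. \<Sum>k\<le>l. hit_prob l k) \<longlonglongrightarrow> 1 / \<mu>"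
proof -
  let ?\<psi> = "(1 + sqrt 5) / 2 :: real"
  have inv: "\<phi> * ?\<psi> = 1" by (simp add: phi field_simps)
  have "(\<lambda>n. real (fib (Suc n)) / (?\<psi> ^ Suc n / sqrt 5) * (1 / \<mu>)) \<longlonglongrightarrow> 1 * (1 / \<mu>)"
    by (intro tendsto_mult_right filterlim_compose[OF fib_asymptotics filterlim_Suc])
  also have "(\<lambda>n. real (fib (Suc n)) / (?\<psi> ^ Suc n / sqrt 5) * (1 / \<mu>)) = (\<lambda>l. \<Sum>k\<le>l. hit_prob l k)"
  proof
    fix n
    define P where "P = ?\<psi> ^ Suc n"
    have P: "\<phi> ^ Suc n * P = 1" by (simp only: P_def inv power_one flip: power_mult_distrib)
    then have "P \<noteq> 0" by auto
    with P have "1 / P = \<phi> ^ Suc n" by (simp add: divide_eq_eq)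
    moreover have "real (fib (Suc n)) / (P / sqrt 5) * (1 / \<mu>) = real (fib (Suc n)) * (1 / P * sqrt 5 / \<mu>)"
      by simp
    ultimately have "real (fib (Suc n)) / (P / sqrt 5) * (1 / \<mu>) = real (fib (Suc n)) * (\<phi> ^ Suc n * sqrt 5 / \<mu>)"
      by (simp only:)
    also have "\<phi> ^ Suc n * sqrt 5 / \<mu> = \<phi> ^ n"
      using phi_bounds by (simp add: \<mu>_def)
    also have "real (fib (Suc n)) * \<phi> ^ n = (\<Sum>k\<le>n. hit_prob n k)"
      unfolding hit_prob_def by (simp only: of_nat_sum sum_distrib_right flip: sum_choose_fib)
    finally show "real (fib (Suc n)) / (?\<psi> ^ Suc n / sqrt 5) * (1 / \<mu>) = (\<Sum>k\<le>n. hit_prob n k)"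
      unfolding P_def .
  qed
  finally show ?thesis by simp
qed

text \<open>Sums over \<open>k\<close> turn into integrals of this step function, which makes Scheffe's lemma applicable.\<close>
definition rescaled :: "nat \<Rightarrow> real \<Rightarrow> real" where
  "rescaled l x = (let k = \<lfloor>real l / \<mu> + sqrt l * x\<rfloor>
     in if 0 \<le> k \<and> k \<le> int l then sqrt l * hit_prob l (nat k) else 0)"

text \<open>Steps have width \<open>1 / sqrt l\<close>. Exponent 1 gives the total probability,
  exponent \<open>N\<close> the sum to be estimated.\<close>

lemma has_bochner_integral_rescaled_power:
  assumes "l > 0" "N > 0"
  shows "has_bochner_integral lborel (\<lambda>x. rescaled l x ^ N) (sqrt l ^ N * (\<Sum>k\<le>l. hit_prob l k ^ N) / sqrt l)"
proof -
  define h where "h k = (if 0 \<le> k \<and> k \<le> int l then sqrt l * hit_prob l (nat k) else 0) ^ N" for k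
  have "has_bochner_integral lborel (\<lambda>x. h \<lfloor>real l / \<mu> + sqrt l * x\<rfloor>) ((\<Sum>k\<in>{0..int l}. h k) / sqrt l)"
    using assms by (intro has_bochner_integral_floor) (auto simp: h_def)
  also have "(\<Sum>k\<in>{0..int l}. h k) = (\<Sum>k\<le>l. (sqrt l * hit_prob l k) ^ N)"
    by (rule sum.reindex_bij_witness[where i = int and j = nat]) (auto simp: h_def)
  also have "\<dots> = sqrt l ^ N * (\<Sum>k\<le>l. hit_prob l k ^ N)"
    by (simp add: power_mult_distrib sum_distrib_left)
  finally show ?thesis by (simp add: h_def rescaled_def Let_def)
qed

lemma hit_prob_nonneg: "hit_prob l k \<ge> 0"
  using phi_bounds by (simp add: hit_prob_def)

lemma rescaled_nonneg: "rescaled l x \<ge> 0"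
  by (simp add: rescaled_def Let_def hit_prob_nonneg)

lemma phi2_bounds: "0 < \<phi>\<^sup>2" "\<phi>\<^sup>2 < 1"
  using phi_bounds by (simp_all add: phi_square)

text \<open>Only \<open>k\<close> with \<open>l \<le> 2 * k\<close> contribute, so
  \<open>sqrt l\<close> is at most \<open>sqrt 2 * sqrt k\<close> and the uniform binomial bound
  applies.\<close>

lemma rescaled_bounded: obtains C where "\<And>l x. rescaled l x \<le> C"
proof -
  obtain C where C: "C > 0"
    "\<And>k j. sqrt k * (real (k choose j) * (\<phi>\<^sup>2) ^ j * (1 - \<phi>\<^sup>2) ^ (k - j)) \<le> C"
    using binomial_prob_bound[OF phi2_bounds] by blast
  have *: "sqrt l * hit_prob l k \<le> sqrt 2 * C" if "k \<le> l" for l k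
  proof (cases "l \<le> 2 * k")
    case True
    have "sqrt l * hit_prob l k \<le> sqrt (2 * k) * hit_prob l k"
      using True by (intro mult_right_mono hit_prob_nonneg) (simp flip: of_nat_mult)
    also have "\<dots> = sqrt 2 * (sqrt k * hit_prob l k)" by (simp add: real_sqrt_mult)
    also have "\<dots> \<le> sqrt 2 * C"
      using C(2)[of k "l - k"] hit_prob_binomial[OF that] by (intro mult_left_mono) auto
    finally show ?thesis .
  next
    case False
    then have "k < l - k" by simp
    then show ?thesis using C by (simp add: hit_prob_def binomial_eq_0)
  qed
  show thesis
    by (rule that[of "sqrt 2 * C"]) (use * C in \<open>auto simp: rescaled_def Let_def\<close>)
qed

text \<open>For \<open>k\<close> near \<open>l / \<mu> + x * sqrt l\<close>, the normalised
  deviation \<open>(l - k * \<mu>) / sqrt k\<close> tends to the argument used here, and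
  \<open>sqrt (l / k)\<close> to the prefactor. The total mass is 1 / \<mu>, not 1.\<close>

definition limit_density :: "real \<Rightarrow> real" where
  "limit_density x = sqrt \<mu> * normal_density 0 (sqrt (\<phi>\<^sup>2 * (1 - \<phi>\<^sup>2))) (- \<mu> * x * sqrt \<mu>)"

lemma rescaled_tendsto: "(\<lambda>l. rescaled l x) \<longlonglongrightarrow> limit_density x"
proof -
  define \<sigma> where "\<sigma> = sqrt (\<phi>\<^sup>2 * (1 - \<phi>\<^sup>2))"
  have \<sigma>: "\<sigma> > 0" using phi2_bounds by (simp add: \<sigma>_def)
  obtain e :: "nat \<Rightarrow> real" where e: "e \<longlonglongrightarrow> 0"
    "\<And>k j. k > 0 \<Longrightarrow> \<bar>sqrt k * (real (k choose j) * (\<phi>\<^sup>2) ^ j * (1 - \<phi>\<^sup>2) ^ (k - j))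
       - normal_density 0 \<sigma> ((real j - real k * \<phi>\<^sup>2) / sqrt k)\<bar> \<le> e k"
    using binomial_local_limit[OF phi2_bounds] unfolding \<sigma>_def by blast
  define K where "K l = \<lfloor>real l / \<mu> + sqrt l * x\<rfloor>" for l :: nat
  \<comment> \<open>The rounding error of \<open>K\<close>; it is bounded, hence negligible at scale
    \<open>sqrt l\<close>.\<close>
  define r where "r l = frac (real l / \<mu> + sqrt l * x)" for l :: nat
  have K_eq: "real_of_int (K l) = real l / \<mu> + sqrt l * x - r l" for l
    by (simp add: K_def r_def frac_def)
  have inv_sqrt: "(\<lambda>l. inverse (sqrt (real l))) \<longlonglongrightarrow> 0"
    by (intro tendsto_inverse_0_at_top filterlim_compose[OF sqrt_at_top] filterlim_real_sequentially)
  have r_lim: "(\<lambda>l. r l * inverse (sqrt (real l))) \<longlonglongrightarrow> 0"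
  proof (rule Lim_null_comparison[OF _ inv_sqrt])
    have "0 \<le> r l" "r l \<le> 1" for l
      using frac_lt_1[of "real l / \<mu> + sqrt l * x"] by (simp_all add: r_def)
    then show "\<forall>\<^sub>F l in sequentially. norm (r l * inverse (sqrt (real l))) \<le> inverse (sqrt (real l))"
      by (intro always_eventually allI) (simp add: abs_mult mult_left_le_one_le)
  qed
  have quot_lim: "(\<lambda>l. K l / real l) \<longlonglongrightarrow> 1 / \<mu>"
  proof (rule Lim_transform_eventually)
    have "(\<lambda>l. 1 / \<mu> + (x - r l * inverse (sqrt (real l))) * inverse (sqrt (real l)))
        \<longlonglongrightarrow> 1 / \<mu> + (x - 0) * 0"
      by (intro tendsto_intros inv_sqrt r_lim)
    then show "(\<lambda>l. 1 / \<mu> + (x - r l * inverse (sqrt (real l))) * inverse (sqrt (real l))) \<longlonglongrightarrow> 1 / \<mu>"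
      by simp
    show "\<forall>\<^sub>F l in sequentially. 1 / \<mu> + (x - r l * inverse (sqrt (real l))) * inverse (sqrt (real l)) = K l / real l"
      using eventually_gt_at_top[of 0]
    proof eventually_elim
      case (elim l)
      define s where "s = sqrt (real l)"
      have s: "s > 0" "real l = s\<^sup>2" using elim by (auto simp: s_def)
      show ?case unfolding K_eq s_def [symmetric] s(2)
        using s(1) mu_gt_1 by (simp add: field_simps power2_eq_square)
    qed
  qed
  have K_pos: "\<forall>\<^sub>F l in sequentially. K l > 0"
  proof -
    have "\<forall>\<^sub>F l in sequentially. K l / real l > 0"
      using order_tendstoD(1)[OF quot_lim, of 0] mu_gt_1 by simp
    then show ?thesis by eventually_elim (auto simp: zero_less_divide_iff)
  qed
  have K_le: "\<forall>\<^sub>F l in sequentially. K l \<le> int l"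
  proof -
    have "\<forall>\<^sub>F l in sequentially. K l / real l < 1"
      using order_tendstoD(2)[OF quot_lim, of 1] mu_gt_1 by simp
    then show ?thesis using eventually_gt_at_top[of 0]
    proof eventually_elim
      case (elim l)
      then have "real_of_int (K l) < real l" by simp
      then show ?case by linarith
    qed
  qed
  have nat_K: "filterlim (\<lambda>l. nat (K l)) at_top sequentially"
  proof -
    have "filterlim (\<lambda>l. K l / real l * real l) at_top sequentially"
      using mu_gt_1 by (intro filterlim_tendsto_pos_mult_at_top[OF quot_lim] filterlim_real_sequentially) auto
    then have *: "\<forall>\<^sub>F l in sequentially. real Z \<le> K l / real l * real l" for Z :: nat
      by (simp add: filterlim_at_top)
    have "\<forall>\<^sub>F l in sequentially. Z \<le> nat (K l)" for Z
      using *[of Z] eventually_gt_at_top[of 0]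
    proof eventually_elim
      case (elim l)
      then have "real Z \<le> real_of_int (K l)" by simp
      then show ?case by linarith
    qed
    then show ?thesis by (simp add: filterlim_at_top)
  qed
  \<comment> \<open>The argument of the normal density in the local limit theorem for
    \<open>k = K l\<close> and \<open>j = l - k\<close>, where
    \<open>j - k * \<phi>^2 = l - k * \<mu>\<close>, with numerator and denominator divided by
    \<open>sqrt l\<close>.\<close>
  define y where "y l = (- \<mu> * x + \<mu> * (r l * inverse (sqrt (real l)))) / sqrt (K l / real l)" for l
  have "y \<longlonglongrightarrow> (- \<mu> * x + \<mu> * 0) / sqrt (1 / \<mu>)"
    unfolding y_def using mu_gt_1 by (intro tendsto_intros r_lim quot_lim) auto
  then have y_lim: "y \<longlonglongrightarrow> - \<mu> * x * sqrt \<mu>"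
    by (simp add: real_sqrt_divide)
  define b where "b l = sqrt (nat (K l)) * hit_prob l (nat (K l))" for l
  have "(\<lambda>l. b l - normal_density 0 \<sigma> (y l)) \<longlonglongrightarrow> 0"
  proof (rule Lim_null_comparison)
    show "(\<lambda>l. e (nat (K l))) \<longlonglongrightarrow> 0"
      by (rule filterlim_compose[OF e(1) nat_K])
    show "\<forall>\<^sub>F l in sequentially. norm (b l - normal_density 0 \<sigma> (y l)) \<le> e (nat (K l))"
      using K_pos K_le eventually_gt_at_top[of 0]
    proof eventually_elim
      case (elim l)
      have k: "nat (K l) > 0" "nat (K l) \<le> l" "real (nat (K l)) = K l" using elim by auto
      have "y l = (real (l - nat (K l)) - real (nat (K l)) * \<phi>\<^sup>2) / sqrt (nat (K l))"
      proof -
        define s where "s = sqrt (real l)"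
        have s: "s > 0" "real l = s\<^sup>2" using elim by (auto simp: s_def)
        have "real (l - nat (K l)) - real (nat (K l)) * \<phi>\<^sup>2 = real l - K l * \<mu>"
          using k by (simp add: of_nat_diff mu_altdef algebra_simps)
        also have "\<dots> = s * (- \<mu> * x + \<mu> * (r l * inverse s))"
          unfolding K_eq s_def[symmetric] s(2) using mu_gt_1 s(1) by (simp add: field_simps)
        finally show ?thesis
          unfolding y_def k(3) s_def [symmetric] using s(1)
          by (simp add: real_sqrt_divide s_def [symmetric] mult_ac)
      qed
      then show ?case
        using e(2)[OF k(1), of "l - nat (K l)"] hit_prob_binomial[OF k(2)] by (simp add: b_def)
    qed
  qed
  moreover have "(\<lambda>l. normal_density 0 \<sigma> (y l)) \<longlonglongrightarrow> normal_density 0 \<sigma> (- \<mu> * x * sqrt \<mu>)"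
    unfolding normal_density_def using \<sigma> by (intro tendsto_intros y_lim) auto
  ultimately have b_lim: "b \<longlonglongrightarrow> normal_density 0 \<sigma> (- \<mu> * x * sqrt \<mu>)"
    by (rule Lim_transform [rotated])
  \<comment> \<open>Passes from the scale \<open>sqrt k\<close> of the local limit theorem to the
    scale \<open>sqrt l\<close> of \<open>rescaled\<close>.\<close>
  have "(\<lambda>l. inverse (sqrt (K l / real l)) * b l) \<longlonglongrightarrow> inverse (sqrt (1 / \<mu>)) * normal_density 0 \<sigma> (- \<mu> * x * sqrt \<mu>)"
    using mu_gt_1 by (intro tendsto_intros quot_lim b_lim) auto
  also have "inverse (sqrt (1 / \<mu>)) * normal_density 0 \<sigma> (- \<mu> * x * sqrt \<mu>) = limit_density x"
    by (simp add: limit_density_def \<sigma>_def real_sqrt_divide)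
  finally show ?thesis
  proof (rule Lim_transform_eventually)
    show "\<forall>\<^sub>F l in sequentially. inverse (sqrt (K l / real l)) * b l = rescaled l x"
      using K_pos K_le
    proof eventually_elim
      case (elim l)
      then have "real (nat (K l)) = real_of_int (K l)" "sqrt (real_of_int (K l)) \<noteq> 0" by auto
      moreover have "rescaled l x = sqrt l * hit_prob l (nat (K l))"
        unfolding rescaled_def K_def [symmetric] Let_def using elim by simp
      ultimately show ?case by (simp add: b_def real_sqrt_divide)
    qed
  qed
qed

text \<open>Variance, per unit of \<open>l\<close>, of the number of twos among
  \<open>l / \<mu>\<close> steps; it is the base of the power in the constant
  \<open>h\<close>.\<close>

definition v :: real where "v = \<phi>\<^sup>2 * (1 - \<phi>\<^sup>2) / \<mu>"

lemma v_pos: "v > 0"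
  using phi2_bounds mu_gt_1 by (simp add: v_def)

lemma limit_density_altdef:
  "limit_density x = 1 / sqrt (2 * pi * v) * exp (- (\<mu>\<^sup>2 / (2 * v) * x\<^sup>2))"
proof -
  have s: "\<phi>\<^sup>2 * (1 - \<phi>\<^sup>2) = v * \<mu>" using mu_gt_1 by (simp add: v_def)
  show ?thesis
    unfolding limit_density_def normal_density_def s using mu_gt_1 v_pos
    by (simp add: power_mult_distrib real_sqrt_mult field_simps power2_eq_square)
qed

text \<open>The \<open>N\<close>-th power of a Gaussian is again Gaussian, with exponent multiplied
  by \<open>N\<close>.\<close>

lemma has_bochner_integral_limit_density_power:
  assumes "N > 0"
  shows "has_bochner_integral lborel (\<lambda>x. limit_density x ^ N)
     (1 / (\<mu> * sqrt ((2 * pi * v) ^ (N - 1) * real N)))"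
proof -
  have "has_bochner_integral lborel (\<lambda>x. (1 / sqrt (2 * pi * v)) ^ N * exp (- (real N * \<mu>\<^sup>2 / (2 * v) * x\<^sup>2)))
     ((1 / sqrt (2 * pi * v)) ^ N * sqrt (pi / (real N * \<mu>\<^sup>2 / (2 * v))))"
    using assms mu_gt_1 v_pos
    by (intro has_bochner_integral_mult_right has_bochner_integral_exp_minus_square) auto
  also have "(\<lambda>x. (1 / sqrt (2 * pi * v)) ^ N * exp (- (real N * \<mu>\<^sup>2 / (2 * v) * x\<^sup>2))) = (\<lambda>x. limit_density x ^ N)"
    by (simp add: fun_eq_iff limit_density_altdef power_divide mult_ac flip: exp_of_nat_mult)
  also have "pi / (real N * \<mu>\<^sup>2 / (2 * v)) = (2 * pi * v) / (real N * \<mu>\<^sup>2)"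
    by simp
  also have "(1 / sqrt (2 * pi * v)) ^ N * sqrt \<dots> = 1 / (\<mu> * sqrt ((2 * pi * v) ^ (N - 1) * real N))"
  proof -
    define w where "w = sqrt (2 * pi * v)"
    have w: "w > 0" using v_pos by (simp add: w_def)
    obtain M where M: "N = Suc M" using assms by (cases N) auto
    show ?thesis
      unfolding real_sqrt_divide real_sqrt_mult[of _ "real N"] real_sqrt_mult[of "real N"] real_sqrt_power w_def [symmetric]
      using w mu_gt_1 by (simp add: M power_divide field_simps)
  qed
  finally show ?thesis .
qed

lemma sum_hit_prob_power_tendsto:
  assumes "N > 0"
  shows "(\<lambda>l. sqrt l ^ N * (\<Sum>k\<le>l. hit_prob l k ^ N) / sqrt l)
           \<longlonglongrightarrow> 1 / (\<mu> * sqrt ((2 * pi * v) ^ (N - 1) * real N))"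
proof -
  obtain C where C: "\<And>l x. rescaled l x \<le> C" by (rule rescaled_bounded) blast
  note R = has_bochner_integral_rescaled_power[unfolded has_bochner_integral_iff]
  note L = has_bochner_integral_limit_density_power[unfolded has_bochner_integral_iff]
  \<comment> \<open>The index is shifted because the integral formula for \<open>rescaled\<close>
    assumes \<open>l > 0\<close>.\<close>
  have "(\<lambda>n. LINT x|lborel. rescaled (Suc n) x ^ N) \<longlonglongrightarrow> (LINT x|lborel. limit_density x ^ N)"
  proof (rule integral_power_tendsto)
    show "integrable lborel (rescaled (Suc n))" for n using R[of "Suc n" 1] by simp
    show "integrable lborel limit_density" using L[of 1] by simp
    show "(\<lambda>n. rescaled (Suc n) x) \<longlonglongrightarrow> limit_density x" for x
      using rescaled_tendsto by (rule LIMSEQ_Suc)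
    have "(LINT x|lborel. rescaled (Suc n) x) = (\<Sum>k\<le>Suc n. hit_prob (Suc n) k)" for n
      using R[of "Suc n" 1] by (simp del: sum.atMost_Suc)
    moreover have "(LINT x|lborel. limit_density x) = 1 / \<mu>"
      using L[of 1] by simp
    \<comment> \<open>The crucial hypothesis of Scheffe's lemma: the Fibonacci limit and the mass of
      the Gaussian are both 1 / \<mu>, so no mass escapes.\<close>
    ultimately show "(\<lambda>n. LINT x|lborel. rescaled (Suc n) x) \<longlonglongrightarrow> (LINT x|lborel. limit_density x)"
      using LIMSEQ_Suc[OF sum_hit_prob_tendsto] by (simp del: sum.atMost_Suc)
  qed (use assms C rescaled_nonneg in auto)
  moreover have "(LINT x|lborel. rescaled (Suc n) x ^ N) =
      sqrt (Suc n) ^ N * (\<Sum>k\<le>Suc n. hit_prob (Suc n) k ^ N) / sqrt (Suc n)" for n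
    using R[of "Suc n" N] assms by blast
  moreover have "(LINT x|lborel. limit_density x ^ N) = 1 / (\<mu> * sqrt ((2 * pi * v) ^ (N - 1) * real N))"
    using L[of N] assms by blast
  ultimately show ?thesis
    by - (rule LIMSEQ_imp_Suc, simp only:)
qed

end

section \<open>Matching the limit with the stated constants\<close>

theorem theorem4:
  fixes N :: nat
    and S :: "nat Matrix.vec set"
    and \<phi> A h b\<^sub>0 :: real
  assumes N: "N \<ge> 1"
    and S: "S = {s \<in> carrier_vec N. \<forall>i<N. 1 \<le> vec_index s i \<and> vec_index s i \<le> 2}"
    and phi: "\<phi> = (sqrt 5 - 1) / 2"
    and A: "A = - (\<phi> ^ (N - 1) * (1 + \<phi>) ^ (N - 1) * (1 + 2 * \<phi>))"
    and h: "h = real N * (\<phi> / (1 + 3 * \<phi> + 2 * \<phi> ^ 2)) ^ (N - 1)"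
    and b0: "b\<^sub>0 = 1 / (- \<phi> * A * sqrt ((2 * pi) ^ (N - 1) * h))"
  shows "(\<lambda>l::nat. real (num_alignments N S (Matrix.vec N (\<lambda>i. l))))
           \<sim>[at_top]
         (\<lambda>l. \<phi> powi (- (int l * int N)) * b\<^sub>0 * real l powr ((1 - real N) / 2))"
proof -
  interpret golden \<phi> by unfold_locales (rule phi)
  have [simp]: "\<phi> \<noteq> 0" using phi_bounds by simp
  have inv: "\<phi> * (1 + \<phi>) = 1" using phi_square by (simp add: power2_eq_square algebra_simps)
  have mu: "\<mu> = \<phi> * (1 + 2 * \<phi>)" by (simp add: \<mu>_def sqrt_5)
  \<comment> \<open>Since \<phi> (1 + \<phi>) = 1, the \<open>N\<close>-dependent powers in
    \<open>A\<close> cancel and only the mean step remains.\<close>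
  have "- \<phi> * A = (\<phi> * (1 + \<phi>)) ^ (N - 1) * \<mu>"
    by (simp add: A mu power_mult_distrib mult_ac)
  then have A': "- \<phi> * A = \<mu>" by (simp add: inv)
  have v: "\<phi> / (1 + 3 * \<phi> + 2 * \<phi> ^ 2) = v"
  proof -
    have "1 + 3 * \<phi> + 2 * \<phi>\<^sup>2 = (1 + \<phi>) * (1 + 2 * \<phi>)" by (simp add: power2_eq_square algebra_simps)
    moreover have "v = \<phi> * \<phi> / (1 + 2 * \<phi>)"
      using phi_bounds by (simp add: v_def mu phi_square) (simp add: field_simps flip: phi_square power2_eq_square)
    moreover have "\<phi> / (1 + \<phi>) = \<phi> * \<phi>"
      using inv phi_bounds by (simp add: divide_eq_eq mult.assoc)
    ultimately show ?thesis by (simp flip: divide_divide_eq_left)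
  qed
  have b0': "b\<^sub>0 = 1 / (\<mu> * sqrt ((2 * pi * v) ^ (N - 1) * real N))"
    unfolding b0 A' h v by (simp only: power_mult_distrib mult_ac)
  have b0_nz: "b\<^sub>0 \<noteq> 0" using N mu_gt_1 v_pos by (simp add: b0')
  have "(\<lambda>l. sqrt l ^ N * (\<Sum>k\<le>l. hit_prob l k ^ N) / sqrt l) \<longlonglongrightarrow> b\<^sub>0"
    unfolding b0' using N by (intro sum_hit_prob_power_tendsto) auto
  moreover have "\<forall>\<^sub>F l in sequentially. sqrt l ^ N * (\<Sum>k\<le>l. hit_prob l k ^ N) / sqrt l =
      real (num_alignments N S (Matrix.vec N (\<lambda>i. l))) / (\<phi> powi (- (int l * int N)) * real l powr ((1 - real N) / 2))"
    using eventually_gt_at_top[of 0]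
  proof eventually_elim
    case (elim l)
    \<comment> \<open>Each of the \<open>N\<close> rows contributes a weight
      \<open>\<phi> ^ l\<close>, independent of \<open>k\<close>.\<close>
    have count: "(\<Sum>k\<le>l. hit_prob l k ^ N) = real (num_alignments N S (Matrix.vec N (\<lambda>i. l))) * \<phi> ^ (l * N)"
      using num_alignments_diagonal[of N l] N elim
      by (simp add: S hit_prob_def power_mult_distrib sum_distrib_right power_mult)
    have phi_power: "\<phi> powi (- (int l * int N)) = 1 / \<phi> ^ (l * N)"
      by (simp add: power_int_minus divide_inverse flip: of_nat_mult)
    have "sqrt l ^ N / sqrt l = real l powr (real N / 2) / real l powr (1 / 2)"
      using elim powr_powr[of "real l" "1 / 2" "real N"] by (simp add: powr_half_sqrt powr_realpow)
    also have "\<dots> = real l powr (- ((1 - real N) / 2))"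
    proof -
      have "- ((1 - real N) / 2) = real N / 2 - 1 / 2" by (simp add: diff_divide_distrib)
      then show ?thesis by (simp only: powr_diff)
    qed
    finally have "sqrt l ^ N / sqrt l = 1 / real l powr ((1 - real N) / 2)"
      by (simp only: powr_minus divide_inverse mult_1)
    then have "sqrt l ^ N * Y / sqrt l = 1 / real l powr ((1 - real N) / 2) * Y" for Y
      using times_divide_eq_left[of "sqrt l ^ N" "sqrt l" Y] by (simp only:)
    then show ?case unfolding count phi_power by simp
  qed
  ultimately have "(\<lambda>l. real (num_alignments N S (Matrix.vec N (\<lambda>i. l))) /
      (\<phi> powi (- (int l * int N)) * real l powr ((1 - real N) / 2))) \<longlonglongrightarrow> b\<^sub>0"
    by (rule Lim_transform_eventually)
  from asymp_equivI'_const[OF this b0_nz] show ?thesis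
    by (simp only: mult.commute[of b\<^sub>0] mult.assoc)
qed

end
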